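(* Let $\mathfrak{g}$ be a real $3$-dimensional Lie algebra. (A) If $\mathfrak{g}$ is of type (1), (2), (3), (6) (any $\theta\neq 0$), (7), (8), or of type (4) with $\theta=1$, in the list below, then the real $6$-dimensional product Lie algebra $\mathfrak{g}\times\mathfrak{g}$ carries an integrable complex structure. (B) If $\mathfrak{g}$ is of type (5), or of type (4) with $\theta\neq 1$ (and $\theta\neq 0$), then $\mathfrak{g}\times\mathfrak{g}$ carries no integrable complex structure. Here "$\mathfrak{g}$ is of type $(k)$" means that $\mathfrak{g}$ is isomorphic to $\mathbb{R}^3$ with basis $e_1,e_2,e_3$ and Lie bracket given by line $(k)$ of the following list ($\theta$ is a real parameter): (1) $[e_1,e_3]=0$, $[e_2,e_3]=0$, $[e_1,e_2]=0$; (2) $[e_1,e_3]=0$, $[e_2,e_3]=0$, $[e_1,e_2]=e_1$; (3) $[e_1,e_3]=0$, $[e_2,e_3]=0$, $[e_1,e_2]=e_3$; (4) $[e_1,e_3]=e_1$, $[e_2,e_3]=\theta e_2$, $[e_1,e_2]=0$, with $\theta\neq 0$; (5) $[e_1,e_3]=e_1$, $[e_2,e_3]=e_1+e_2$, $[e_1,e_2]=0$; (6) $[e_1,e_3]=\theta e_1-e_2$, $[e_2,e_3]=e_1+\theta e_2$, $[e_1,e_2]=0$, with $\theta\neq 0$; (7) $[e_1,e_3]=e_2$, $[e_2,e_3]=e_1$, $[e_1,e_2]=e_3$; (8) $[e_1,e_3]=-e_2$, $[e_2,e_3]=e_1$, $[e_1,e_2]=e_3$.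
   Context: The bracket on $\mathfrak{g}\times\mathfrak{g}$ is componentwise: $[(u,v),(t,s)]=([u,t],[v,s])$. A complex structure on a real Lie algebra $\mathfrak{h}$ is an $\mathbb{R}$-linear endomorphism $\mathcal{J}:\mathfrak{h}\to\mathfrak{h}$ with $\mathcal{J}^2=-\mathrm{id}$. It is integrable if for all $v,w\in\mathfrak{h}$ $$N(v,w):=[v,w]+\mathcal{J}[\mathcal{J}v,w]+\mathcal{J}[v,\mathcal{J}w]-[\mathcal{J}v,\mathcal{J}w]=0.$$ *)

theory Defs
  imports "HOL-Analysis.Analysis"
begin

definition lie_algebra :: "('a::real_vector \<Rightarrow> 'a \<Rightarrow> 'a) \<Rightarrow> bool" where
  "lie_algebra br \<longleftrightarrow>
     bilinear br \<and>
     (\<forall>x. br x x = 0) \<and>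
     (\<forall>x y z. br x (br y z) + br y (br z x) + br z (br x y) = 0)"

definition lie_isomorphic ::
  "('a::real_vector \<Rightarrow> 'a \<Rightarrow> 'a) \<Rightarrow> ('b::real_vector \<Rightarrow> 'b \<Rightarrow> 'b) \<Rightarrow> bool" where
  "lie_isomorphic br br' \<longleftrightarrow>
     (\<exists>\<phi>. linear \<phi> \<and> bij \<phi> \<and> (\<forall>x y. \<phi> (br x y) = br' (\<phi> x) (\<phi> y)))"

definition prod_bracket :: "('a \<Rightarrow> 'a \<Rightarrow> 'a) \<Rightarrow> ('a \<times> 'a) \<Rightarrow> ('a \<times> 'a) \<Rightarrow> ('a \<times> 'a)" where
  "prod_bracket br p q = (br (fst p) (fst q), br (snd p) (snd q))"

definition complex_structure :: "('a::real_vector \<Rightarrow> 'a) \<Rightarrow> bool" where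
  "complex_structure J \<longleftrightarrow> linear J \<and> (\<forall>v. J (J v) = - v)"

definition integrable_structure ::
  "('a::real_vector \<Rightarrow> 'a \<Rightarrow> 'a) \<Rightarrow> ('a \<Rightarrow> 'a) \<Rightarrow> bool" where
  "integrable_structure br J \<longleftrightarrow>
     (\<forall>v w. br v w + J (br (J v) w) + J (br v (J w)) - br (J v) (J w) = 0)"

abbreviation e1 :: "real^3" where "e1 \<equiv> axis 1 1"
abbreviation e2 :: "real^3" where "e2 \<equiv> axis 2 1"
abbreviation e3 :: "real^3" where "e3 \<equiv> axis 3 1"

text \<open>
  The unique alternating bilinear map on \<open>real^3\<close> whose values on
  \<open>(e1, e3)\<close>, \<open>(e2, e3)\<close>, \<open>(e1, e2)\<close> are \<open>a\<close>, \<open>b\<close>, \<open>c\<close>, in this order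
  (see \<open>bracket3_basis\<close> below).
\<close>

definition bracket3 :: "real^3 \<Rightarrow> real^3 \<Rightarrow> real^3 \<Rightarrow> real^3 \<Rightarrow> real^3 \<Rightarrow> real^3" where
  "bracket3 a b c x y =
     (x$1 * y$3 - x$3 * y$1) *\<^sub>R a +
     (x$2 * y$3 - x$3 * y$2) *\<^sub>R b +
     (x$1 * y$2 - x$2 * y$1) *\<^sub>R c"

datatype lie3_type =
  Type1 | Type2 | Type3 | Type4 real | Type5 | Type6 real | Type7 | Type8

primrec model_bracket :: "lie3_type \<Rightarrow> real^3 \<Rightarrow> real^3 \<Rightarrow> real^3" where
  "model_bracket Type1 = bracket3 0 0 0"
| "model_bracket Type2 = bracket3 0 0 e1"
| "model_bracket Type3 = bracket3 0 0 e3"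
| "model_bracket (Type4 \<theta>) = bracket3 e1 (\<theta> *\<^sub>R e2) 0"
| "model_bracket Type5 = bracket3 e1 (e1 + e2) 0"
| "model_bracket (Type6 \<theta>) = bracket3 (\<theta> *\<^sub>R e1 - e2) (e1 + \<theta> *\<^sub>R e2) 0"
| "model_bracket Type7 = bracket3 e2 e1 e3"
| "model_bracket Type8 = bracket3 (- e2) e1 e3"

text \<open>The restriction \<open>\<theta> \<noteq> 0\<close> in types 4 and 6 is not part of this definition.\<close>

definition of_type :: "('a::real_vector \<Rightarrow> 'a \<Rightarrow> 'a) \<Rightarrow> lie3_type \<Rightarrow> bool" where
  "of_type br k \<longleftrightarrow> lie_isomorphic br (model_bracket k)"

lemma bracket3_basis:
  "bracket3 a b c e1 e3 = a" "bracket3 a b c e2 e3 = b" "bracket3 a b c e1 e2 = c"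
  by (simp_all add: bracket3_def axis_def)

lemma lie_algebra_model_bracket: "lie_algebra (model_bracket k)"
  by (cases k)
    (simp_all add: lie_algebra_def bilinear_def linear_iff bracket3_def vec_eq_iff forall_3
      axis_def algebra_simps)

lemma lie_algebra_prod_bracket: "lie_algebra br \<Longrightarrow> lie_algebra (prod_bracket br)"
  by (simp add: lie_algebra_def bilinear_def linear_iff prod_bracket_def zero_prod_def)

end

theory Submission
  imports Defs
begin

text \<open>
  Part (A): if \<open>ad e\<^sub>3\<close> commutes with the rotation by a right angle of the plane spanned by
  \<open>e\<^sub>1, e\<^sub>2\<close>, let \<open>J\<close> rotate that plane in each factor and send \<open>e\<^sub>3\<close> of the first factor to
  \<open>e\<^sub>3\<close> of the second. In type (7) the element \<open>e\<^sub>2\<close> takes the role of \<open>e\<^sub>3\<close>.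

  Part (B): let \<open>V\<close> be the derived algebra of \<open>\<gg> \<times> \<gg>\<close>, an abelian ideal of codimension two
  on which the quotient acts by \<open>A \<oplus> 0\<close> and \<open>0 \<oplus> A\<close>, with \<open>A\<close> invertible and not scalar, with
  real eigenvalues. For \<open>x \<in> W = V \<inter> J V\<close> and any \<open>s\<close>, integrability says that
  \<open>S x = [x, s] - [J x, J s]\<close> lies in \<open>W\<close> again and \<open>J (S x) = S (J x)\<close>. In other words, the
  complex subspace \<open>{x + \<i> J x | x \<in> W}\<close> of the complexification of \<open>V\<close> is stable under
  \<open>\<alpha> A \<oplus> \<beta> A\<close>, where \<open>(\<alpha>, \<beta>)\<close> is \<open>s + \<i> J s\<close> modulo \<open>V\<close>. Some \<open>s\<close> makes \<open>\<alpha>\<close> and \<open>\<beta>\<close> linearly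
  independent over the reals; then every eigenvector of \<open>\<alpha> A \<oplus> \<beta> A\<close> is a multiple of a real vector.
  But a real vector \<open>x + \<i> J x\<close> is zero, while \<open>W\<close> is not.
\<close>

section \<open>Transport along Lie isomorphisms\<close>

text \<open>Conjugating \<open>J\<close> by \<open>F\<close>, the isomorphism of products that
  applies \<open>\<phi>\<close> in both factors, preserves both conditions, so the model brackets
  suffice.\<close>

lemma complex_structure_transfer:
  fixes br :: "'a::real_vector \<Rightarrow> 'a \<Rightarrow> 'a" and br' :: "'b::real_vector \<Rightarrow> 'b \<Rightarrow> 'b"
  assumes "lie_isomorphic br br'"
    and "complex_structure J" and "integrable_structure (prod_bracket br) J"
  shows "\<exists>J'. complex_structure J' \<and> integrable_structure (prod_bracket br') J'"
proof -
  obtain \<phi> where phi: "linear \<phi>" "bij \<phi>" and hom: "\<And>x y. \<phi> (br x y) = br' (\<phi> x) (\<phi> y)"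
    using assms(1) unfolding lie_isomorphic_def by blast
  define F where "F = (\<lambda>p. (\<phi> (fst p), \<phi> (snd p)))"
  define G where "G = (\<lambda>p. (inv \<phi> (fst p), inv \<phi> (snd p)))"
  have psi: "linear (inv \<phi>)"
    using phi by (simp add: linear_iff) (metis bij_inv_eq_iff)
  have F: "linear F" and G: "linear G"
    using phi psi by (simp_all add: F_def G_def linear_iff)
  have GF: "G (F p) = p" and FG: "F (G p') = p'" for p p'
    using phi(2) by (simp_all add: F_def G_def bij_is_inj bij_is_surj surj_f_inv_f)
  have FB: "F (prod_bracket br p q) = prod_bracket br' (F p) (F q)" for p q
    by (simp add: F_def prod_bracket_def hom)
  have J: "linear J" "\<And>v. J (J v) = - v"
    using assms(2) unfolding complex_structure_def by blast+
  have "complex_structure (F \<circ> J \<circ> G)"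
    unfolding complex_structure_def
    using J F G by (auto intro!: linear_compose simp: GF FG linear_neg)
  moreover have "integrable_structure (prod_bracket br') (F \<circ> J \<circ> G)"
    unfolding integrable_structure_def
  proof (intro allI)
    fix v w
    have BF: "prod_bracket br' (F p) (F q) = F (prod_bracket br p q)" for p q
      by (simp add: FB)
    have "prod_bracket br (G v) (G w) + J (prod_bracket br (J (G v)) (G w))
        + J (prod_bracket br (G v) (J (G w))) - prod_bracket br (J (G v)) (J (G w)) = 0"
      using assms(3) unfolding integrable_structure_def by blast
    from arg_cong[OF this, of F]
    have "F (prod_bracket br (G v) (G w)) + F (J (prod_bracket br (J (G v)) (G w)))
        + F (J (prod_bracket br (G v) (J (G w)))) - F (prod_bracket br (J (G v)) (J (G w))) = 0"
      using F by (simp add: linear_add linear_diff linear_0)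
    then show "prod_bracket br' v w + (F \<circ> J \<circ> G) (prod_bracket br' ((F \<circ> J \<circ> G) v) w)
        + (F \<circ> J \<circ> G) (prod_bracket br' v ((F \<circ> J \<circ> G) w))
        - prod_bracket br' ((F \<circ> J \<circ> G) v) ((F \<circ> J \<circ> G) w) = 0"
      using BF[of "G v" "G w"] BF[of "J (G v)" "G w"] BF[of "G v" "J (G w)"]
        BF[of "J (G v)" "J (G w)"]
      by (simp add: GF FG)
  qed
  ultimately show ?thesis by blast
qed

lemma lie_isomorphic_sym:
  assumes "lie_isomorphic br br'"
  shows "lie_isomorphic br' br"
proof -
  obtain \<phi> where phi: "linear \<phi>" "bij \<phi>" and hom: "\<And>x y. \<phi> (br x y) = br' (\<phi> x) (\<phi> y)"
    using assms unfolding lie_isomorphic_def by blast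
  have "linear (inv \<phi>)"
    using phi by (simp add: linear_iff) (metis bij_inv_eq_iff)
  moreover have "inv \<phi> (br' x y) = br (inv \<phi> x) (inv \<phi> y)" for x y
    by (metis phi(2) bij_inv_eq_iff hom)
  ultimately show ?thesis
    unfolding lie_isomorphic_def using bij_imp_bij_inv[OF phi(2)] by blast
qed

section \<open>Part (A): explicit complex structures\<close>

definition rotation12 :: "(real^3) \<times> (real^3) \<Rightarrow> (real^3) \<times> (real^3)" where
  "rotation12 p = (vector [- fst p $ 2, fst p $ 1, - snd p $ 3],
    vector [- snd p $ 2, snd p $ 1, fst p $ 3])"

definition rotation31 :: "(real^3) \<times> (real^3) \<Rightarrow> (real^3) \<times> (real^3)" where
  "rotation31 p = (vector [fst p $ 3, - snd p $ 2, - fst p $ 1],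
    vector [snd p $ 3, fst p $ 2, - snd p $ 1])"

lemma complex_structure_rotation:
  "complex_structure rotation12" "complex_structure rotation31"
  by (simp_all add: complex_structure_def rotation12_def rotation31_def linear_iff prod_eq_iff
      vec_eq_iff forall_3)

text \<open>N is alternating, antilinear with respect to J, and zero on pairs (v, J v); brackets
  across the factors vanish. What remains is J [x, e3] = [J x, e3] for x in the plane of
  \<open>e1\<close>, \<open>e2\<close>.\<close>

lemma integrable_rotation12:
  assumes "k \<in> {Type1, Type2, Type3, Type4 1, Type8} \<or> (\<exists>\<theta>. k = Type6 \<theta>)"
  shows "integrable_structure (prod_bracket (model_bracket k)) rotation12"
  using assms
  by (auto simp: integrable_structure_def prod_bracket_def rotation12_def bracket3_def
      prod_eq_iff vec_eq_iff forall_3 axis_def algebra_simps)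

text \<open>Here ad \<open>e3\<close> is a reflection of the plane of \<open>e1\<close>,
  \<open>e2\<close> and anticommutes with the rotation, whereas ad \<open>e2\<close> sends
  \<open>e1\<close> to \<open>- e3\<close> and \<open>e3\<close> to \<open>e1\<close>, as
  \<open>rotation31\<close> does.\<close>

lemma integrable_rotation31:
  "integrable_structure (prod_bracket (model_bracket Type7)) rotation31"
  by (auto simp: integrable_structure_def prod_bracket_def rotation31_def bracket3_def
      prod_eq_iff vec_eq_iff forall_3 axis_def algebra_simps)

lemma exists_complex_structure:
  assumes "of_type br k"
    and "k \<in> {Type1, Type2, Type3, Type4 1, Type7, Type8} \<or> (\<exists>\<theta>. k = Type6 \<theta>)"
  shows "\<exists>J. complex_structure J \<and> integrable_structure (prod_bracket br) J"
proof -
  have "\<exists>J. complex_structure J \<and> integrable_structure (prod_bracket (model_bracket k)) J"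
    using assms(2) integrable_rotation12[of k] integrable_rotation31 complex_structure_rotation
    by blast
  then show ?thesis
    using assms(1) complex_structure_transfer lie_isomorphic_sym unfolding of_type_def by blast
qed

section \<open>Real vectors in invariant complex subspaces\<close>

text \<open>The map T in the third assumption is \<alpha> A on the first pair and \<beta> A on the
  second, with A upper triangular of diagonal 1, \<mu>. Polynomials in T isolate the first block and
  then produce an eigenvector of A, which is a multiple of a real vector.\<close>

lemma invariant_subspace_real_vector_fst:
  fixes U :: "(complex \<times> complex \<times> complex \<times> complex) set" and \<alpha> \<beta> :: complex and \<delta> \<mu> :: real
  assumes add: "\<And>x y. x \<in> U \<Longrightarrow> y \<in> U \<Longrightarrow> x + y \<in> U"
    and scale: "\<And>k a b c d. (a, b, c, d) \<in> U \<Longrightarrow> (k * a, k * b, k * c, k * d) \<in> U"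
    and T: "\<And>a b c d. (a, b, c, d) \<in> U \<Longrightarrow>
      (\<alpha> * (a + of_real \<delta> * b), \<alpha> * of_real \<mu> * b,
       \<beta> * (c + of_real \<delta> * d), \<beta> * of_real \<mu> * d) \<in> U"
    and indep: "Im (\<alpha> * cnj \<beta>) \<noteq> 0"
    and mu: "\<mu> \<noteq> 0" and nonscalar: "\<delta> \<noteq> 0 \<or> \<mu> \<noteq> 1"
    and z: "(a, b, c, d) \<in> U" "(a, b) \<noteq> (0, 0)"
  shows "\<exists>p q :: real. (p, q) \<noteq> (0, 0) \<and> (of_real p, of_real q, 0, 0) \<in> U"
proof -
  \<comment> \<open>Independence over the reals keeps the eigenvalues \<alpha>, \<alpha> \<mu> of
    the first block away from \<beta>, \<beta> \<mu>.\<close>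
  have ne: "\<alpha> \<noteq> of_real t * \<beta>" "of_real t * \<alpha> \<noteq> \<beta>" for t
    using indep by (auto simp: algebra_simps)
  have alpha: "\<alpha> \<noteq> 0" using indep by auto
  have T': "(\<alpha> * (a + of_real \<delta> * b) - k * a, \<alpha> * of_real \<mu> * b - k * b,
      \<beta> * (c + of_real \<delta> * d) - k * c, \<beta> * of_real \<mu> * d - k * d) \<in> U"
    if "(a, b, c, d) \<in> U" for k a b c d
    using add[OF T[OF that] scale[OF that, of "- k"]] by simp
  txt \<open>Applying \<open>(T - \<beta>) (T - \<beta> \<mu>)\<close> kills the second component and is injective on the first.\<close>
  define a' b' where "a' = \<alpha> * (a + of_real \<delta> * b) - \<beta> * of_real \<mu> * a"
    and "b' = \<alpha> * of_real \<mu> * b - \<beta> * of_real \<mu> * b"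
  define a'' b'' where "a'' = \<alpha> * (a' + of_real \<delta> * b') - \<beta> * a'"
    and "b'' = \<alpha> * of_real \<mu> * b' - \<beta> * b'"
  have ab'': "(a'', b'', 0, 0) \<in> U"
    using T'[OF T'[OF z(1), of "\<beta> * of_real \<mu>"], of \<beta>]
    by (simp add: a''_def b''_def a'_def b'_def algebra_simps)
  have nz: "(a'', b'') \<noteq> (0, 0)"
  proof (cases "b = 0")
    case True
    then have "a'' = (\<alpha> - \<beta>) * (\<alpha> - of_real \<mu> * \<beta>) * a"
      by (simp add: a''_def a'_def b'_def algebra_simps)
    then show ?thesis using z(2) True ne(1)[of 1] ne(1)[of \<mu>] by simp
  next
    case False
    have "b'' = (of_real \<mu> * \<alpha> - \<beta>) * (\<alpha> - \<beta>) * of_real \<mu> * b"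
      by (simp add: b''_def b'_def algebra_simps)
    then show ?thesis using False mu ne(1)[of 1] ne(2)[of \<mu>] by simp
  qed
  \<comment> \<open>T - \<alpha> \<mu> sends the vector of \<open>ab''\<close> to
    \<open>(\<alpha> * k, 0, 0, 0)\<close>. If \<open>k\<close> is zero, that vector is itself an
    eigenvector for \<alpha> \<mu>, and this eigenspace in the first block is a real line because A
    is not scalar.\<close>
  define k where "k = (1 - of_real \<mu>) * a'' + of_real \<delta> * b''"
  have kU: "(\<alpha> * k, 0, 0, 0) \<in> U"
    using T'[OF ab'', of "\<alpha> * of_real \<mu>"] by (simp add: k_def algebra_simps)
  show ?thesis
  proof (cases "k = 0")
    case False
    then have "(of_real 1, of_real 0, 0, 0) \<in> U"
      using scale[OF kU, of "1 / (\<alpha> * k)"] alpha by simp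
    then show ?thesis by (metis prod.inject zero_neq_one)
  next
    case k: True
    show ?thesis
    proof (cases "\<delta> = 0")
      case True
      then have "a'' = 0" "b'' \<noteq> 0"
        using k nonscalar nz by (auto simp: k_def)
      then have "(of_real 0, of_real 1, 0, 0) \<in> U"
        using scale[OF ab'', of "1 / b''"] by simp
      then show ?thesis by (metis prod.inject zero_neq_one)
    next
      case False
      have b: "b'' = of_real (- (1 - \<mu>) / \<delta>) * a''"
      proof -
        have "of_real \<delta> * b'' = - ((1 - of_real \<mu>) * a'')"
          using k by (simp add: k_def eq_neg_iff_add_eq_0 add.commute)
        then have "b'' = - ((1 - of_real \<mu>) * a'') / of_real \<delta>"
          using False by (metis nonzero_mult_div_cancel_left of_real_eq_0_iff)
        then show ?thesis using False by (simp add: field_simps)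
      qed
      with nz have "a'' \<noteq> 0" by auto
      then have "(of_real 1, of_real (- (1 - \<mu>) / \<delta>), 0, 0) \<in> U"
        using scale[OF ab'', of "1 / a''"] unfolding b by simp
      then show ?thesis by (metis prod.inject zero_neq_one)
    qed
  qed
qed

lemma invariant_subspace_real_vector:
  fixes U :: "(complex \<times> complex \<times> complex \<times> complex) set" and \<alpha> \<beta> :: complex and \<delta> \<mu> :: real
  assumes add: "\<And>x y. x \<in> U \<Longrightarrow> y \<in> U \<Longrightarrow> x + y \<in> U"
    and scale: "\<And>k a b c d. (a, b, c, d) \<in> U \<Longrightarrow> (k * a, k * b, k * c, k * d) \<in> U"
    and T: "\<And>a b c d. (a, b, c, d) \<in> U \<Longrightarrow>
      (\<alpha> * (a + of_real \<delta> * b), \<alpha> * of_real \<mu> * b,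
       \<beta> * (c + of_real \<delta> * d), \<beta> * of_real \<mu> * d) \<in> U"
    and indep: "Im (\<alpha> * cnj \<beta>) \<noteq> 0"
    and mu: "\<mu> \<noteq> 0" and nonscalar: "\<delta> \<noteq> 0 \<or> \<mu> \<noteq> 1"
    and z: "z \<in> U" "z \<noteq> 0"
  shows "\<exists>p q r s :: real. (p, q, r, s) \<noteq> 0 \<and>
    (of_real p, of_real q, of_real r, of_real s) \<in> U"
proof -
  obtain a b c d where abcd: "z = (a, b, c, d)" by (cases z)
  show ?thesis
  proof (cases "(a, b) = (0, 0)")
    case False
    then have "\<exists>p q :: real. (p, q) \<noteq> (0, 0) \<and> (of_real p, of_real q, 0, 0) \<in> U"
      using invariant_subspace_real_vector_fst[OF add scale T indep mu nonscalar] z(1) abcd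
      by blast
    then obtain p q :: real where
      "(p, q) \<noteq> (0, 0)" "(complex_of_real p, complex_of_real q, 0, 0) \<in> U"
      by blast
    then have "(p, q, 0, 0) \<noteq> (0 :: real \<times> real \<times> real \<times> real)"
      "(of_real p, of_real q, of_real 0, of_real 0) \<in> U"
      by (auto simp: zero_prod_def)
    then show ?thesis by blast
  next
    case True
    \<comment> \<open>Swapping the two pairs exchanges \<alpha> and \<beta> and reduces to the
      previous case.\<close>
    define U' where "U' = {(c, d, a, b) | a b c d. (a, b, c, d) \<in> U}"
    have U': "(c, d, a, b) \<in> U' \<longleftrightarrow> (a, b, c, d) \<in> U" for a b c d
      by (auto simp: U'_def)
    have cd: "(c, d) \<noteq> (0, 0)" using True z(2) abcd by (auto simp: zero_prod_def)
    have "\<exists>p q :: real. (p, q) \<noteq> (0, 0) \<and> (of_real p, of_real q, 0, 0) \<in> U'"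
    proof (rule invariant_subspace_real_vector_fst[of U' \<beta> \<delta> \<mu> \<alpha> c d a b])
      show "x + y \<in> U'" if "x \<in> U'" "y \<in> U'" for x y
      proof -
        obtain a b c d a' b' c' d' where xy: "x = (c, d, a, b)" "y = (c', d', a', b')"
          by (metis surj_pair)
        then show ?thesis
          using that add[of "(a, b, c, d)" "(a', b', c', d')"] by (simp add: U')
      qed
      show "Im (\<beta> * cnj \<alpha>) \<noteq> 0" using indep by (simp add: algebra_simps)
    qed (use scale T mu nonscalar cd z(1) abcd in \<open>auto simp: U'\<close>)
    then obtain p q :: real where
      "(p, q) \<noteq> (0, 0)" "(0, 0, complex_of_real p, complex_of_real q) \<in> U"
      unfolding U' by blast
    then have "(0, 0, p, q) \<noteq> (0 :: real \<times> real \<times> real \<times> real)"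
      "(of_real 0, of_real 0, of_real p, of_real q) \<in> U"
      by (auto simp: zero_prod_def)
    then show ?thesis by blast
  qed
qed

section \<open>Position of J relative to the derived algebra V\<close>

text \<open>Otherwise J preserves V and acts on the real plane of classes modulo V with every vector
  an eigenvector; a real eigenvalue \<open>a\<close> would satisfy a^2 = -1.\<close>

lemma exists_independent_mod_derived:
  fixes J :: "(real^3) \<times> (real^3) \<Rightarrow> (real^3) \<times> (real^3)"
  assumes "complex_structure J"
  shows "\<exists>s. fst s $ 3 * snd (J s) $ 3 - snd s $ 3 * fst (J s) $ 3 \<noteq> 0"
proof (rule ccontr)
  assume "\<not> ?thesis"
  then have dep: "fst s $ 3 * snd (J s) $ 3 = snd s $ 3 * fst (J s) $ 3" for s
    by (simp del: split_paired_All split_paired_Ex)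
  have J: "linear J" "\<And>v. J (J v) = - v"
    using assms unfolding complex_structure_def by blast+
  \<comment> \<open>Comparing \<open>dep\<close> at \<open>(e3, 0)\<close> and at its translate by
    \<open>v\<close> gives the second coordinate; \<open>(0, e3)\<close> gives the first.\<close>
  have V: "fst (J v) $ 3 = 0 \<and> snd (J v) $ 3 = 0" if "fst v $ 3 = 0" "snd v $ 3 = 0" for v
  proof
    have "J (v + u) = J v + J u" for u
      using J(1) by (rule linear_add)
    then show "snd (J v) $ 3 = 0" "fst (J v) $ 3 = 0"
      using dep[of "v + (e3, 0)"] dep[of "(e3, 0)"] dep[of "v + (0, e3)"] dep[of "(0, e3)"] that
      by (simp_all add: axis_def)
  qed
  define a where "a = fst (J (e3, 0)) $ 3"
  \<comment> \<open>By \<open>b\<close> and the choice of \<open>a\<close>, this vector lies in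
    V.\<close>
  define v where "v = J (e3, 0) - a *\<^sub>R (e3, 0)"
  have b: "snd (J (e3, 0)) $ 3 = 0"
    using dep[of "(e3, 0)"] by (simp add: axis_def)
  have "fst (J v) $ 3 = 0"
    using V[of v] b by (simp add: v_def a_def axis_def)
  moreover have "J v = - (e3, 0) - a *\<^sub>R J (e3, 0)"
    using J by (simp add: v_def linear_diff linear_scale del: scaleR_Pair)
  ultimately have "- 1 - a * a = 0"
    by (simp add: axis_def a_def)
  then show False
    using zero_le_square[of a] by linarith
qed

text \<open>Membership of J x in V is two linear conditions; \<open>g\<close> parametrizes a
  three-dimensional subspace of V.\<close>

lemma exists_nonzero_in_derived:
  fixes J :: "(real^3) \<times> (real^3) \<Rightarrow> (real^3) \<times> (real^3)"
  assumes "linear J"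
  shows "\<exists>x. x \<noteq> 0 \<and> fst x $ 3 = 0 \<and> snd x $ 3 = 0 \<and> fst (J x) $ 3 = 0 \<and> snd (J x) $ 3 = 0"
proof -
  define g :: "real^3 \<Rightarrow> (real^3) \<times> (real^3)"
    where "g t = (vector [t $ 1, t $ 2, 0], vector [t $ 3, 0, 0])" for t
  define f where "f t = (fst (J (g t)) $ 3, snd (J (g t)) $ 3)" for t
  have g: "linear g"
    by (simp add: g_def linear_iff prod_eq_iff vec_eq_iff forall_3)
  then have f: "linear f"
    using assms by (auto intro!: linearI simp: f_def linear_add linear_scale)
  have "\<not> inj f"
  proof
    assume "inj f"
    then have "dim (f ` UNIV) = dim (UNIV :: (real^3) set)"
      using f by (simp add: dim_image_eq)
    moreover have "dim (f ` UNIV) \<le> 2"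
      using dim_subset_UNIV[of "f ` UNIV"] by simp
    ultimately show False by simp
  qed
  then obtain t where t: "f t = 0" "t \<noteq> 0"
    using f linear_injective_0 by blast
  then have "g t \<noteq> 0"
    by (auto simp: g_def prod_eq_iff vec_eq_iff forall_3)
  with t show ?thesis
    by (intro exI[of _ "g t"]) (auto simp: f_def g_def zero_prod_def)
qed

section \<open>Part (B): nonexistence\<close>

text \<open>A common form of both types: \<delta> = 0, \<mu> = \<theta> is type (4), and \<delta> =
  \<mu> = 1 is type (5).\<close>

lemma no_complex_structure_model:
  fixes \<delta> \<mu> :: real
  assumes mu: "\<mu> \<noteq> 0" and nonscalar: "\<delta> \<noteq> 0 \<or> \<mu> \<noteq> 1"
    and cs: "complex_structure J"
    and int: "integrable_structure (prod_bracket (bracket3 e1 (\<delta> *\<^sub>R e1 + \<mu> *\<^sub>R e2) 0)) J"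
  shows False
proof -
  let ?br = "prod_bracket (bracket3 e1 (\<delta> *\<^sub>R e1 + \<mu> *\<^sub>R e2) 0)"
  have lin: "linear J" and JJ: "J (J v) = - v" for v
    using cs unfolding complex_structure_def by blast+
  obtain s where s: "fst s $ 3 * snd (J s) $ 3 - snd s $ 3 * fst (J s) $ 3 \<noteq> 0"
    using exists_independent_mod_derived[OF cs] by blast
  define \<alpha> \<beta> where "\<alpha> = Complex (fst s $ 3) (fst (J s) $ 3)"
    and "\<beta> = Complex (snd s $ 3) (snd (J s) $ 3)"
  define W where
    "W = {x. fst x $ 3 = 0 \<and> snd x $ 3 = 0 \<and> fst (J x) $ 3 = 0 \<and> snd (J x) $ 3 = 0}"
  \<comment> \<open>The vector x + \<i> J x in the coordinates \<open>e1\<close>, \<open>e2\<close>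
    of each factor; on \<open>W\<close> the third coordinates vanish.\<close>
  define Z where "Z x = (Complex (fst x $ 1) (fst (J x) $ 1), Complex (fst x $ 2) (fst (J x) $ 2),
      Complex (snd x $ 1) (snd (J x) $ 1), Complex (snd x $ 2) (snd (J x) $ 2))" for x
  have Z0: "x = 0" if "x \<in> W" "Z x = (of_real a, of_real b, of_real c, of_real d)" for x a b c d
  proof -
    have "J x = 0"
      using that by (simp add: W_def Z_def complex_eq_iff prod_eq_iff vec_eq_iff forall_3)
    then show ?thesis
      using JJ[of x] lin by (simp add: linear_0)
  qed
  have "\<exists>p q r t :: real. (p, q, r, t) \<noteq> 0 \<and>
      (of_real p, of_real q, of_real r, of_real t) \<in> Z ` W"
  proof -
    have add: "x + y \<in> Z ` W" if xy: "x \<in> Z ` W" "y \<in> Z ` W" for x y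
    proof -
      obtain u v where "u \<in> W" "v \<in> W" "x = Z u" "y = Z v" using xy by blast
      then have "u + v \<in> W" "x + y = Z (u + v)"
        using lin by (simp_all add: W_def Z_def linear_add complex_eq_iff)
      then show ?thesis by blast
    qed
    have scale: "(k * a, k * b, k * c, k * d) \<in> Z ` W" if xy: "(a, b, c, d) \<in> Z ` W" for k a b c d
    proof -
      obtain u where u: "u \<in> W" "(a, b, c, d) = Z u" using xy by blast
      \<comment> \<open>The real part of k (u + \<i> J u); applying J gives its imaginary
        part.\<close>
      let ?v = "Re k *\<^sub>R u - Im k *\<^sub>R J u"
      have "J ?v = Re k *\<^sub>R J u + Im k *\<^sub>R u"
        using lin JJ by (simp add: linear_diff linear_scale)
      then have "?v \<in> W" "(k * a, k * b, k * c, k * d) = Z ?v"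
        using u by (simp_all add: W_def Z_def complex_eq_iff)
      then show ?thesis by blast
    qed
    have T: "(\<alpha> * (a + of_real \<delta> * b), \<alpha> * of_real \<mu> * b,
       \<beta> * (c + of_real \<delta> * d), \<beta> * of_real \<mu> * d) \<in> Z ` W"
      if xy: "(a, b, c, d) \<in> Z ` W" for a b c d
    proof -
      obtain u where u: "u \<in> W" "(a, b, c, d) = Z u" using xy by blast
      let ?v = "?br u s - ?br (J u) (J s)"
      \<comment> \<open>Integrability is taken at \<open>(J u, s)\<close>, so that J of
        \<open>?v\<close> becomes [J u, s] + [u, J s]. Thus \<open>?v\<close> and its image are the
        real and imaginary parts of the complexified bracket of u + \<i> J u and s + \<i> J
        s.\<close>
      have eq: "?br (J u) s + J (?br (- u) s) + J (?br (J u) (J s)) - ?br (- u) (J s) = 0"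
        using int[unfolded integrable_structure_def, rule_format, of "J u" s] by (simp add: JJ)
      have neg: "?br (- u) w = - ?br u w" for w
        by (simp add: prod_bracket_def bracket3_def vec_eq_iff algebra_simps)
      have Jv: "J ?v = ?br (J u) s + ?br u (J s)"
        using eq lin by (simp add: neg linear_diff linear_neg algebra_simps)
      have "?v \<in> W"
        using u(1) unfolding W_def mem_Collect_eq Jv
        by (simp add: prod_bracket_def bracket3_def axis_def)
      moreover have "(\<alpha> * (a + of_real \<delta> * b), \<alpha> * of_real \<mu> * b,
       \<beta> * (c + of_real \<delta> * d), \<beta> * of_real \<mu> * d) = Z ?v"
        using u unfolding Z_def Jv
        by (simp add: W_def \<alpha>_def \<beta>_def complex_eq_iff prod_bracket_def bracket3_def axis_def
            algebra_simps)
      ultimately show ?thesis by blast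
    qed
    have indep: "Im (\<alpha> * cnj \<beta>) \<noteq> 0"
      using s by (simp add: \<alpha>_def \<beta>_def algebra_simps)
    obtain x where x: "x \<noteq> 0" "x \<in> W"
      using exists_nonzero_in_derived[OF lin] by (auto simp: W_def)
    have "Z x \<noteq> 0"
      using Z0[of x 0 0 0 0] x by (auto simp: zero_prod_def)
    then show ?thesis
      using invariant_subspace_real_vector[OF add scale T indep mu nonscalar, of "Z x"] x(2)
      by blast
  qed
  then obtain p q r t :: real and x where nz: "(p, q, r, t) \<noteq> 0" and x: "x \<in> W"
    and Zx: "Z x = (of_real p, of_real q, of_real r, of_real t)"
    by (metis imageE)
  have "x = 0" using Z0[OF x Zx] .
  then show False
    using nz Zx lin by (simp add: Z_def linear_0 complex_eq_iff zero_prod_def)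
qed

lemma no_complex_structure:
  assumes "of_type br Type5 \<or> (\<exists>\<theta>. \<theta> \<noteq> 1 \<and> \<theta> \<noteq> 0 \<and> of_type br (Type4 \<theta>))"
  shows "\<not> (\<exists>J. complex_structure J \<and> integrable_structure (prod_bracket br) J)"
proof -
  obtain \<delta> \<mu> :: real where "\<mu> \<noteq> 0" "\<delta> \<noteq> 0 \<or> \<mu> \<noteq> 1"
    and iso: "lie_isomorphic br (bracket3 e1 (\<delta> *\<^sub>R e1 + \<mu> *\<^sub>R e2) 0)"
  proof (cases "of_type br Type5")
    case True
    then show ?thesis using that[of 1 1] by (simp add: of_type_def)
  next
    case False
    then obtain \<theta> where "\<theta> \<noteq> 1" "\<theta> \<noteq> 0" "of_type br (Type4 \<theta>)" using assms by blast
    \<comment> \<open>Instantiation follows order of occurrence: \<open>\<theta>\<close> is for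
      \<open>\<mu>\<close>, \<open>0\<close> for \<open>\<delta>\<close>.\<close>
    then show ?thesis using that[of \<theta> 0] by (simp add: of_type_def)
  qed
  then show ?thesis
    using complex_structure_transfer[OF iso] no_complex_structure_model by blast
qed

theorem theorem1:
  fixes br :: "'a::real_vector \<Rightarrow> 'a \<Rightarrow> 'a"
  assumes "lie_algebra br"
    and "dim (UNIV :: 'a set) = 3"
  shows
    "(of_type br Type1 \<or> of_type br Type2 \<or> of_type br Type3 \<or>
      (\<exists>\<theta>. \<theta> \<noteq> 0 \<and> of_type br (Type6 \<theta>)) \<or>
      of_type br Type7 \<or> of_type br Type8 \<or> of_type br (Type4 1)
        \<longrightarrow> (\<exists>J :: 'a \<times> 'a \<Rightarrow> 'a \<times> 'a.
              complex_structure J \<and> integrable_structure (prod_bracket br) J)) \<and>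
     (of_type br Type5 \<or> (\<exists>\<theta>. \<theta> \<noteq> 1 \<and> \<theta> \<noteq> 0 \<and> of_type br (Type4 \<theta>))
        \<longrightarrow> \<not> (\<exists>J :: 'a \<times> 'a \<Rightarrow> 'a \<times> 'a.
              complex_structure J \<and> integrable_structure (prod_bracket br) J))"
  using exists_complex_structure[of br] no_complex_structure[of br] by blast

end
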